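(* Assume that $F^{\mathbb Q}(y)=1-g(S(y))$ for $y\ge 0$, where the distortion function $g$ is convex and differentiable. Then the optimal indemnity function for the insurer's mean-variance problem is $I^*(t,y)=(y-d_t^* )_+$, where $$d_t^*=\inf\Big\{d\ge 0:\ 1+\gamma e^{r(T-t)}d-(1+\theta)\frac{g(S(d))}{S(d)}\ge 0\Big\},$$ that is, for every $t\in[0,T]$ the function $y\mapsto (y-d_t^* )_+$ attains $\inf_{I\in\mathcal C}H(t,I)$.
   Context: Constants: $T>0$, $r>0$, $\gamma>0$, $\theta\ge 0$. $Y$ is a positive random variable (claim size) considered under two probability measures $\mathbb P$ (insurer) and $\mathbb Q$ (reinsurer), with finite first and second moments under both. $F$ and $F^{\mathbb Q}$ are its distribution functions under $\mathbb P$ and $\mathbb Q$; $S=1-F$; $F$ has a density. $\mathbb E$ is expectation under $\mathbb P$, $\mathbb E^{\mathbb Q}$ under $\mathbb Q$. $x_+=\max\{x,0\}$. A distortion function is a non-decreasing $g:[0,1]\to[0,1]$ with $g(0)=0$, $g(1)=1$. When $S(d)=0$, the quotient $g(S(d))/S(d)$ is read as its limit $g'(0)$. $\mathcal C:=\{f:\mathbb R_+\to\mathbb R_+ \mid f(0)=0,\ 0\le f(y)-f(x)\le y-x\ \text{for all } x\le y\}$. $H(t,I):=(1+\theta)\mathbb E^{\mathbb Q}[I(Y)]+\mathbb E[Y-I(Y)]+\dfrac{\gamma e^{r(T-t)}}{2}\mathbb E[(Y-I(Y))^2]$ for $I\in\mathcal C$. The insurer's problem: maximise $\mathbb E_{t,x}[X(T)]-\frac{\gamma}{2}\mathrm{Var}_{t,x}[X(T)]$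 over reinsurance strategies $\{I(t,\cdot)\}$ with $I(t,\cdot)\in\mathcal C$, where $X$ is a Cramér–Lundberg surplus with claims $Y_i$ (intensity 1), interest rate $r$, and reinsurance premium rate $(1+\theta)\mathbb E^{\mathbb Q}[I(t,Y)]$. It is solved in the time-consistent (equilibrium) sense; via the extended HJB system, the optimal indemnity function means a family $I^*(t,\cdot)\in\mathcal C$ attaining $\inf_{I\in\mathcal C}H(t,I)$ for every $t\in[0,T]$. Standing assumptions: the likelihood ratio $\mathrm{LR}$ of $\mathbb Q$ against $\mathbb P$ (Borel, nonnegative, with $\mathbb Q(Y\in E\cap\{\mathrm{LR}<\infty\})=\int_E\mathrm{LR}\,dF$ for all Borel $E$) has finite variation; $\mathrm{LR}$ and $F$ are non-differentiable at only finitely many points; and for every $t$ each of the finitely many intervals between consecutive such points (starting at $0$, the last one unbounded) can be partitioned into finitely many sub-intervals on each of which the function $y\mapsto 1-\frac{(1+\theta)\mathrm{LR}'(y)}{\gamma e^{r(T-t)}}$ is either everywhere $>1$, everywhere in $[0,1]$, or everywhere $<0$. *)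

theory Defs
  imports "HOL-Probability.Probability"
begin

text \<open>
  Functions on \<open>[0,\<infinity>)\<close> are functions of type \<^typ>\<open>real \<Rightarrow> real\<close> whose values on
  negative arguments are left unconstrained; the claim size is assumed to be
  positive on the whole sample space, so these values never enter an expectation.
\<close>

definition indemnities :: "(real \<Rightarrow> real) set" where
  "indemnities = {f. f 0 = 0 \<and> (\<forall>x\<ge>0. 0 \<le> f x) \<and>
     (\<forall>x y. 0 \<le> x \<and> x \<le> y \<longrightarrow> 0 \<le> f y - f x \<and> f y - f x \<le> y - x)}"

definition mv_cost ::
  "'a measure \<Rightarrow> 'a measure \<Rightarrow> ('a \<Rightarrow> real) \<Rightarrow> real \<Rightarrow> real \<Rightarrow> real \<Rightarrow> real \<Rightarrow>
   real \<Rightarrow> (real \<Rightarrow> real) \<Rightarrow> real" where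
  "mv_cost P Q Y T r \<gamma> \<theta> t I =
     (1 + \<theta>) * (LINT \<omega>|Q. I (Y \<omega>)) + (LINT \<omega>|P. Y \<omega> - I (Y \<omega>)) +
     \<gamma> * exp (r * (T - t)) / 2 * (LINT \<omega>|P. (Y \<omega> - I (Y \<omega>))\<^sup>2)"

definition optimal_indemnity ::
  "'a measure \<Rightarrow> 'a measure \<Rightarrow> ('a \<Rightarrow> real) \<Rightarrow> real \<Rightarrow> real \<Rightarrow> real \<Rightarrow> real \<Rightarrow>
   (real \<Rightarrow> real \<Rightarrow> real) \<Rightarrow> bool" where
  "optimal_indemnity P Q Y T r \<gamma> \<theta> I \<longleftrightarrow>
     (\<forall>t\<in>{0..T}. is_arg_min (mv_cost P Q Y T r \<gamma> \<theta> t) (\<lambda>J. J \<in> indemnities) (I t))"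

text \<open>Only the restriction of a distortion function to \<open>[0,1]\<close> is meaningful.\<close>

definition distortion :: "(real \<Rightarrow> real) \<Rightarrow> bool" where
  "distortion g \<longleftrightarrow> g \<in> {0..1} \<rightarrow> {0..1} \<and> mono_on {0..1} g \<and> g 0 = 0 \<and> g 1 = 1"

text \<open>
  The quotient \<open>g(s) / s\<close>, read at \<open>s = 0\<close> as its limit, which is the one-sided
  derivative of \<open>g\<close> at \<open>0\<close> because \<open>g(0) = 0\<close>.
\<close>

definition distortion_quotient :: "(real \<Rightarrow> real) \<Rightarrow> real \<Rightarrow> real" where
  "distortion_quotient g s = (if s = 0 then Lim (at_right 0) (\<lambda>u. g u / u) else g s / s)"

definition deductible ::
  "real \<Rightarrow> real \<Rightarrow> real \<Rightarrow> real \<Rightarrow> (real \<Rightarrow> real) \<Rightarrow> (real \<Rightarrow> real) \<Rightarrow> real \<Rightarrow> real" where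
  "deductible T r \<gamma> \<theta> g S t =
     Inf {d. 0 \<le> d \<and>
       1 + \<gamma> * exp (r * (T - t)) * d - (1 + \<theta>) * distortion_quotient g (S d) \<ge> 0}"

definition likelihood_ratio ::
  "'a measure \<Rightarrow> 'a measure \<Rightarrow> ('a \<Rightarrow> real) \<Rightarrow> (real \<Rightarrow> ennreal) \<Rightarrow> bool" where
  "likelihood_ratio P Q Y LR \<longleftrightarrow> LR \<in> borel_measurable borel \<and>
     (\<forall>E\<in>sets borel. emeasure Q {\<omega> \<in> space Q. Y \<omega> \<in> E \<and> LR (Y \<omega>) < \<infinity>} =
        (\<integral>\<^sup>+y\<in>E. LR y \<partial>distr P borel Y))"

text \<open>
  The likelihood ratio takes values in \<open>[0,\<infinity>]\<close>. Its variation and its derivative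
  are those of its finite part \<^term>\<open>\<lambda>y. enn2real (LR y)\<close>, in which the value
  \<open>\<infinity>\<close> is replaced by \<open>0\<close>.

  A partition of an interval is encoded by a monotone sequence, of which a finite
  initial segment is used.
\<close>

definition finite_variation_on :: "real set \<Rightarrow> (real \<Rightarrow> real) \<Rightarrow> bool" where
  "finite_variation_on A f \<longleftrightarrow>
     (\<exists>B. \<forall>n (x :: nat \<Rightarrow> real). mono x \<and> range x \<subseteq> A \<longrightarrow>
        (\<Sum>i<n. \<bar>f (x (Suc i)) - f (x i)\<bar>) \<le> B)"

definition break_points :: "(real \<Rightarrow> real) \<Rightarrow> (real \<Rightarrow> real) \<Rightarrow> real set" where
  "break_points lr F = {y. y > 0 \<and> \<not> (lr differentiable at y \<and> F differentiable at y)}"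

definition marginal_slope ::
  "real \<Rightarrow> real \<Rightarrow> real \<Rightarrow> real \<Rightarrow> (real \<Rightarrow> real) \<Rightarrow> real \<Rightarrow> real \<Rightarrow> real" where
  "marginal_slope T r \<gamma> \<theta> lr t y = 1 - (1 + \<theta>) * deriv lr y / (\<gamma> * exp (r * (T - t)))"

text \<open>
  For a finite set \<open>N\<close> of positive numbers, the connected components of
  \<open>(0,\<infinity>) - N\<close> are the open intervals between consecutive points of
  \<open>{0} \<union> N\<close> together with the unbounded last one.
\<close>

definition piecewise_slope_regimes :: "(real \<Rightarrow> real) \<Rightarrow> real set \<Rightarrow> bool" where
  "piecewise_slope_regimes \<phi> N \<longleftrightarrow>
     (\<forall>J\<in>components ({0<..} - N). \<exists>\<K>. finite \<K> \<and> partition_on J \<K> \<and>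
        (\<forall>K\<in>\<K>. is_interval K \<and>
           ((\<forall>y\<in>K. \<phi> y > 1) \<or> (\<forall>y\<in>K. 0 \<le> \<phi> y \<and> \<phi> y \<le> 1) \<or> (\<forall>y\<in>K. \<phi> y < 0))))"

end

theory Submission
  imports Defs
begin

text \<open>
  Write \<open>a = 1 + \<theta>\<close>, \<open>c = \<gamma> exp (r (T - t))\<close> and \<open>D = d\<^sup>*\<close>. The integrand of the cost is convex in the
  retained loss \<open>y - I(y)\<close>, and its pointwise tangent at the retention \<open>min y D\<close> of the
  stop-loss contract has slope \<open>1 + c min y D\<close>. Since \<open>y - I(y) \<le> y\<close>, this
  slope may be replaced by the constant \<open>1 + c D\<close>: where \<open>min y D < D\<close>, no contract retains more
  than stop-loss does (\<open>quadratic_tangent_at_deductible\<close>). Writing \<open>h(y) = y - I(y) - min y D\<close>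
  for the extra retention, the excess cost of \<open>I\<close> is therefore at least
  \<open>(1 + c D) E[h(Y)] - a E\<^sup>Q[h(Y)]\<close>.

  The function \<open>h\<close> is the difference of two non-decreasing functions: the part of the loss above
  \<open>D\<close> that \<open>I\<close> retains, and the part below \<open>D\<close> that \<open>I\<close> cedes. Each is a superposition of
  indicators of tail events \<open>{Y > z}\<close>, with \<open>z > D\<close> for the first and \<open>z < D\<close> for the second,
  so it suffices to compare \<open>(1 + c D) P(Y > z)\<close> with \<open>a Q(Y > z)\<close> for one \<open>z\<close> at a time
  (\<open>expectation_le_if_tails_le\<close>). As \<open>Q(Y > z) = g(S(z))\<close>, this is a comparison of \<open>1 + c D\<close> with
  \<open>a g(S(z)) / S(z)\<close> wherever \<open>S(z) > 0\<close>. Since \<open>g\<close> is convex and vanishes at \<open>0\<close>, this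
  quotient is non-increasing in \<open>z\<close>, while \<open>1 + c z\<close> increases. Their order therefore changes
  at \<open>D\<close>, in the direction that each of the two parts requires (\<open>deductible_separates_tails\<close>).
\<close>

section \<open>Comparing expectations through tail probabilities\<close>

lemma nn_integral_layer_cake:
  fixes X :: "'a \<Rightarrow> real"
  assumes "sigma_finite_measure M" and [measurable]: "X \<in> borel_measurable M"
  shows "(\<integral>\<^sup>+\<omega>. ennreal (X \<omega>) \<partial>M) =
    (\<integral>\<^sup>+u. indicator {0<..} u * emeasure M {\<omega> \<in> space M. u < X \<omega>} \<partial>lborel)"
proof -
  interpret M: sigma_finite_measure M by fact
  interpret pair_sigma_finite lborel M ..
  have "ennreal (X \<omega>) = (\<integral>\<^sup>+u. indicator {0<..<X \<omega>} u \<partial>lborel)" for \<omega>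
    by (cases "0 \<le> X \<omega>") (auto simp: ennreal_neg)
  moreover have indicator_split: "indicator {0<..<X \<omega>} u =
      (indicator {0<..} u * (if u < X \<omega> then 1 else 0) :: ennreal)" for \<omega> u
    by (simp add: indicator_def)
  ultimately have "(\<integral>\<^sup>+\<omega>. ennreal (X \<omega>) \<partial>M) =
      (\<integral>\<^sup>+\<omega>. (\<integral>\<^sup>+u. indicator {0<..} u * (if u < X \<omega> then 1 else 0) \<partial>lborel) \<partial>M)"
    by (simp add: indicator_split)
  also have "\<dots> = (\<integral>\<^sup>+u. (\<integral>\<^sup>+\<omega>. indicator {0<..} u * (if u < X \<omega> then 1 else 0) \<partial>M) \<partial>lborel)"
    by (rule Fubini') measurable
  also have "\<dots> = (\<integral>\<^sup>+u. indicator {0<..} u * emeasure M {\<omega> \<in> space M. u < X \<omega>} \<partial>lborel)"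
  proof (rule nn_integral_cong)
    fix u :: real
    have "(\<integral>\<^sup>+\<omega>. (if u < X \<omega> then 1 else 0) \<partial>M) =
        (\<integral>\<^sup>+\<omega>. indicator {\<omega> \<in> space M. u < X \<omega>} \<omega> \<partial>M)"
      by (rule nn_integral_cong) (simp add: indicator_def)
    then show "(\<integral>\<^sup>+\<omega>. indicator {0<..} u * (if u < X \<omega> then 1 else 0) \<partial>M) =
        indicator {0<..} u * emeasure M {\<omega> \<in> space M. u < X \<omega>}"
      by (simp add: nn_integral_cmult)
  qed
  finally show ?thesis .
qed

lemma expectation_le_if_exceedance_le:
  fixes X :: "'a \<Rightarrow> real"
  assumes "finite_measure M" "finite_measure N"
    and int: "integrable M X" "integrable N X"
    and nonneg: "\<And>\<omega>. \<omega> \<in> space M \<Longrightarrow> 0 \<le> X \<omega>" "\<And>\<omega>. \<omega> \<in> space N \<Longrightarrow> 0 \<le> X \<omega>"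
    and "0 \<le> \<alpha>" "0 \<le> \<beta>"
    and le: "\<And>u. 0 < u \<Longrightarrow> \<alpha> * measure M {\<omega> \<in> space M. u < X \<omega>} \<le>
                               \<beta> * measure N {\<omega> \<in> space N. u < X \<omega>}"
  shows "\<alpha> * (LINT \<omega>|M. X \<omega>) \<le> \<beta> * (LINT \<omega>|N. X \<omega>)"
proof -
  interpret M: finite_measure M by fact
  interpret N: finite_measure N by fact
  have [measurable]: "X \<in> borel_measurable M" "X \<in> borel_measurable N"
    using int by auto
  have meas: "(\<lambda>u. emeasure M {\<omega> \<in> space M. u < X \<omega>}) \<in> borel_measurable lborel"
    "(\<lambda>u. emeasure N {\<omega> \<in> space N. u < X \<omega>}) \<in> borel_measurable lborel"
    by measurable
  have "ennreal (\<alpha> * (LINT \<omega>|M. X \<omega>)) = ennreal \<alpha> * (\<integral>\<^sup>+\<omega>. ennreal (X \<omega>) \<partial>M)"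
    using int nonneg \<open>0 \<le> \<alpha>\<close> by (subst nn_integral_eq_integral) (auto simp: ennreal_mult')
  also have "\<dots> = (\<integral>\<^sup>+u. ennreal \<alpha> * (indicator {0<..} u * emeasure M {\<omega> \<in> space M. u < X \<omega>}) \<partial>lborel)"
    using meas by (simp add: nn_integral_layer_cake M.sigma_finite_measure_axioms nn_integral_cmult)
  also have "\<dots> \<le> (\<integral>\<^sup>+u. ennreal \<beta> * (indicator {0<..} u * emeasure N {\<omega> \<in> space N. u < X \<omega>}) \<partial>lborel)"
    using le \<open>0 \<le> \<alpha>\<close> \<open>0 \<le> \<beta>\<close>
    by (intro nn_integral_mono)
       (auto simp: indicator_def M.emeasure_eq_measure N.emeasure_eq_measure
          simp flip: ennreal_mult' intro!: ennreal_leI)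
  also have "\<dots> = ennreal \<beta> * (\<integral>\<^sup>+\<omega>. ennreal (X \<omega>) \<partial>N)"
    using meas by (simp add: nn_integral_layer_cake N.sigma_finite_measure_axioms nn_integral_cmult)
  also have "\<dots> = ennreal (\<beta> * (LINT \<omega>|N. X \<omega>))"
    using int nonneg \<open>0 \<le> \<beta>\<close> by (subst nn_integral_eq_integral) (auto simp: ennreal_mult')
  finally show ?thesis
    using nonneg \<open>0 \<le> \<beta>\<close> by (subst (asm) ennreal_le_iff) (auto intro!: mult_nonneg_nonneg integral_nonneg_AE)
qed

text \<open>
  The threshold is the last point at which \<open>h\<close> is at most \<open>u\<close>; continuity makes \<open>h\<close> equal to
  \<open>u\<close> there, and this tells later on which side of the deductible the threshold lies.
\<close>

lemma superlevel_set_is_ray: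
  fixes h :: "real \<Rightarrow> real"
  assumes cont: "continuous_on {0..} h" and mono: "mono_on {0..} h"
    and "h 0 \<le> u" "0 \<le> y1" "u < h y1"
  obtains z where "0 \<le> z" "h z = u" "\<And>y. 0 \<le> y \<Longrightarrow> u < h y \<longleftrightarrow> z < y"
proof -
  define B where "B = {y \<in> {0..y1}. h y = u}"
  have c1: "continuous_on {0..y1} h"
    using cont by (rule continuous_on_subset) auto
  have ne: "B \<noteq> {}"
    using IVT'[of h 0 u y1] assms c1 by (auto simp: B_def)
  have "closed B"
    unfolding B_def using continuous_closed_preimage_constant[OF c1] by simp
  moreover have bdd: "bdd_above B"
    by (auto simp: B_def intro!: bdd_aboveI[of _ y1])
  ultimately have z: "Sup B \<in> B"
    using closed_contains_Sup ne by blast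
  show thesis
  proof (rule that[of "Sup B"])
    show "0 \<le> Sup B" "h (Sup B) = u" using z by (auto simp: B_def)
    fix y :: real assume "0 \<le> y"
    show "u < h y \<longleftrightarrow> Sup B < y"
    proof
      assume "u < h y"
      show "Sup B < y"
      proof (rule ccontr)
        assume "\<not> Sup B < y"
        then have "h y \<le> h (Sup B)"
          using \<open>0 \<le> y\<close> by (intro mono_onD[OF mono]) auto
        with \<open>u < h y\<close> z show False by (simp add: B_def)
      qed
    next
      assume less: "Sup B < y"
      have "y \<notin> B" using less cSup_upper[OF _ bdd] by fastforce
      moreover have "u \<le> h y"
        using mono_onD[OF mono, of "Sup B" y] z less \<open>0 \<le> y\<close> by (auto simp: B_def)
      moreover have "u < h y" if "y1 < y"
        using mono_onD[OF mono, of y1 y] that \<open>0 \<le> y1\<close> \<open>0 \<le> y\<close> \<open>u < h y1\<close> by auto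
      ultimately show "u < h y"
        using \<open>0 \<le> y\<close> by (force simp: B_def)
    qed
  qed
qed

text \<open>
  The exceedance events of a non-decreasing function of \<open>Y\<close> are tail events of \<open>Y\<close>. A threshold
  \<open>z\<close> enters only if \<open>h\<close> is positive at \<open>z\<close> and not yet at its supremum; for a function that
  grows only above (or only below) a given point, this restricts the tails to be compared.
\<close>

lemma expectation_le_if_tails_le:
  fixes Y :: "'a \<Rightarrow> real"
  assumes "finite_measure M" "finite_measure N"
    and int: "integrable M (\<lambda>\<omega>. h (Y \<omega>))" "integrable N (\<lambda>\<omega>. h (Y \<omega>))"
    and pos: "\<And>\<omega>. \<omega> \<in> space M \<Longrightarrow> 0 \<le> Y \<omega>" "\<And>\<omega>. \<omega> \<in> space N \<Longrightarrow> 0 \<le> Y \<omega>"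
    and cont: "continuous_on {0..} h" and mono: "mono_on {0..} h" and h0: "h 0 = 0"
    and "0 \<le> \<alpha>" "0 \<le> \<beta>"
    and le: "\<And>z y. 0 \<le> z \<Longrightarrow> 0 < h z \<Longrightarrow> 0 \<le> y \<Longrightarrow> h z < h y \<Longrightarrow>
       \<alpha> * measure M {\<omega> \<in> space M. z < Y \<omega>} \<le> \<beta> * measure N {\<omega> \<in> space N. z < Y \<omega>}"
  shows "\<alpha> * (LINT \<omega>|M. h (Y \<omega>)) \<le> \<beta> * (LINT \<omega>|N. h (Y \<omega>))"
proof (rule expectation_le_if_exceedance_le[OF assms(1,2) int])
  have "0 \<le> h y" if "0 \<le> y" for y
    using mono_onD[OF mono, of 0 y] that h0 by simp
  then show "\<And>\<omega>. \<omega> \<in> space M \<Longrightarrow> 0 \<le> h (Y \<omega>)" "\<And>\<omega>. \<omega> \<in> space N \<Longrightarrow> 0 \<le> h (Y \<omega>)"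
    using pos by auto
  fix u :: real assume "0 < u"
  show "\<alpha> * measure M {\<omega> \<in> space M. u < h (Y \<omega>)} \<le> \<beta> * measure N {\<omega> \<in> space N. u < h (Y \<omega>)}"
  proof (cases "\<exists>y\<ge>0. u < h y")
    case True
    then obtain y where y: "0 \<le> y" "u < h y" by blast
    obtain z where z: "0 \<le> z" "h z = u" "\<And>y. 0 \<le> y \<Longrightarrow> u < h y \<longleftrightarrow> z < y"
      using superlevel_set_is_ray[OF cont mono, of u y] y h0 \<open>0 < u\<close> by auto
    have "{\<omega> \<in> space M. u < h (Y \<omega>)} = {\<omega> \<in> space M. z < Y \<omega>}"
      "{\<omega> \<in> space N. u < h (Y \<omega>)} = {\<omega> \<in> space N. z < Y \<omega>}"
      using z(3) pos by auto
    then show ?thesis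
      using le[of z y] z y \<open>0 < u\<close> by simp
  next
    case False
    then have "{\<omega> \<in> space M. u < h (Y \<omega>)} = {}" "{\<omega> \<in> space N. u < h (Y \<omega>)} = {}"
      using pos by auto
    then show ?thesis by (metis measure_empty mult_zero_right order_refl)
  qed
qed fact+

section \<open>Indemnity functions\<close>

lemma indemnitiesD:
  assumes "I \<in> indemnities"
  shows indemnity_zero: "I 0 = 0"
    and indemnity_nonneg: "0 \<le> x \<Longrightarrow> 0 \<le> I x"
    and indemnity_mono: "0 \<le> x \<Longrightarrow> x \<le> y \<Longrightarrow> I x \<le> I y"
    and indemnity_growth: "0 \<le> x \<Longrightarrow> x \<le> y \<Longrightarrow> I y - I x \<le> y - x"
    and indemnity_le: "0 \<le> x \<Longrightarrow> I x \<le> x"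
proof -
  show "I 0 = 0" "0 \<le> x \<Longrightarrow> 0 \<le> I x"
    and "0 \<le> x \<Longrightarrow> x \<le> y \<Longrightarrow> I x \<le> I y"
    and growth: "0 \<le> x \<Longrightarrow> x \<le> y \<Longrightarrow> I y - I x \<le> y - x" for x y
    using assms unfolding indemnities_def by auto
  show "0 \<le> x \<Longrightarrow> I x \<le> x"
    using growth[of 0 x] \<open>I 0 = 0\<close> by simp
qed

lemma indemnity_continuous_on:
  assumes "I \<in> indemnities"
  shows "continuous_on {0..} I"
proof (rule continuous_onI)
  fix x e :: real assume x: "x \<in> {0..}" "0 < e"
  have "dist (I y) (I x) \<le> e" if "y \<in> {0..}" "dist y x < e" for y
    using that x indemnity_mono[OF assms, of x y] indemnity_growth[OF assms, of x y]
      indemnity_mono[OF assms, of y x] indemnity_growth[OF assms, of y x]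
    by (cases "x \<le> y") (auto simp: dist_real_def)
  then show "\<exists>d>0. \<forall>x'\<in>{0..}. dist x' x < d \<longrightarrow> dist (I x') (I x) \<le> e"
    using x(2) by blast
qed

lemma stop_loss_in_indemnities:
  assumes "0 \<le> D"
  shows "(\<lambda>y. max (y - D) 0) \<in> indemnities"
  using assms by (auto simp: indemnities_def)

lemma integrable_dominated_by_claim:
  fixes Y :: "'a \<Rightarrow> real"
  assumes "integrable M Y" and pos: "\<And>\<omega>. \<omega> \<in> space M \<Longrightarrow> 0 \<le> Y \<omega>"
    and cont: "continuous_on {0..} h" and bound: "\<And>y. 0 \<le> y \<Longrightarrow> \<bar>h y\<bar> \<le> y"
  shows "integrable M (\<lambda>\<omega>. h (Y \<omega>))"
    and "integrable M (\<lambda>\<omega>. (Y \<omega>)\<^sup>2) \<Longrightarrow> integrable M (\<lambda>\<omega>. (h (Y \<omega>))\<^sup>2)"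
proof -
  have [measurable]: "Y \<in> borel_measurable M" using assms(1) by auto
  have "continuous_on UNIV (\<lambda>y. h (max 0 y))"
    by (rule continuous_on_compose2[OF cont]) (auto intro!: continuous_intros)
  then have [measurable]: "(\<lambda>y. h (max 0 y)) \<in> borel_measurable borel"
    by (rule borel_measurable_continuous_onI)
  have "(\<lambda>\<omega>. h (max 0 (Y \<omega>))) \<in> borel_measurable M" by measurable
  also have "?this \<longleftrightarrow> (\<lambda>\<omega>. h (Y \<omega>)) \<in> borel_measurable M"
    using pos by (intro measurable_cong) (simp add: max_absorb2)
  finally have [measurable]: "(\<lambda>\<omega>. h (Y \<omega>)) \<in> borel_measurable M" .
  have "\<And>\<omega>. \<omega> \<in> space M \<Longrightarrow> \<bar>h (Y \<omega>)\<bar> \<le> Y \<omega>" using bound pos by auto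
  then show "integrable M (\<lambda>\<omega>. h (Y \<omega>))"
    by (intro Bochner_Integration.integrable_bound[OF assms(1)]) (auto intro!: AE_I2 intro: order_trans[OF _ abs_ge_self])
  assume "integrable M (\<lambda>\<omega>. (Y \<omega>)\<^sup>2)"
  moreover have "(h (Y \<omega>))\<^sup>2 \<le> (Y \<omega>)\<^sup>2" if "\<omega> \<in> space M" for \<omega>
    using bound[of "Y \<omega>"] pos[OF that] power_mono[of "\<bar>h (Y \<omega>)\<bar>" "Y \<omega>" 2] by simp
  ultimately show "integrable M (\<lambda>\<omega>. (h (Y \<omega>))\<^sup>2)"
    by (elim Bochner_Integration.integrable_bound) (auto intro!: AE_I2)
qed

section \<open>Optimality of a deductible that separates the tails\<close>

text \<open>
  The square is convex, with slope \<open>2 min y D\<close> at \<open>min y D\<close>. Where this slope is smaller than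
  \<open>2 D\<close>, the retention \<open>min y D\<close> is all of \<open>y\<close>, so that \<open>R - min y D \<le> 0\<close> and raising the slope to
  \<open>2 D\<close> weakens the bound.
\<close>

lemma quadratic_tangent_at_deductible:
  fixes R y D :: real
  assumes "R \<le> y"
  shows "2 * D * (R - min y D) \<le> R\<^sup>2 - (min y D)\<^sup>2"
proof -
  have "0 \<le> (R - min y D) * (min y D - D)"
    using assms by (cases "y \<le> D") (auto intro: mult_nonpos_nonpos)
  moreover have "0 \<le> (R - min y D)\<^sup>2" by simp
  ultimately show ?thesis
    unfolding power2_eq_square by (simp only: algebra_simps)
qed

text \<open>
  Here \<open>\<kappa>\<close> is the marginal cost of retention at the deductible, and \<open>below\<close> and \<open>above\<close> say that
  a layer of the loss at height \<open>z\<close> is better retained if \<open>z < D\<close> and better ceded if \<open>z > D\<close>.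
  Any other contract differs from stop-loss by ceding layers of the first kind and retaining
  layers of the second.
\<close>

lemma stop_loss_cost_le:
  fixes Y :: "'a \<Rightarrow> real"
  assumes "finite_measure P" "finite_measure Q" and space: "space Q = space P"
    and pos: "\<And>\<omega>. \<omega> \<in> space P \<Longrightarrow> 0 \<le> Y \<omega>"
    and YP: "integrable P Y" "integrable P (\<lambda>\<omega>. (Y \<omega>)\<^sup>2)" and YQ: "integrable Q Y"
    and "0 \<le> \<gamma>" "0 \<le> \<theta>" "0 \<le> D"
    and slope: "\<kappa> = 1 + \<gamma> * exp (r * (T - t)) * D"
    and below: "\<And>z. 0 \<le> z \<Longrightarrow> z < D \<Longrightarrow>
      \<kappa> * measure P {\<omega> \<in> space P. z < Y \<omega>} \<le> (1 + \<theta>) * measure Q {\<omega> \<in> space Q. z < Y \<omega>}"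
    and above: "\<And>z. D < z \<Longrightarrow>
      (1 + \<theta>) * measure Q {\<omega> \<in> space Q. z < Y \<omega>} \<le> \<kappa> * measure P {\<omega> \<in> space P. z < Y \<omega>}"
    and I: "I \<in> indemnities"
  shows "mv_cost P Q Y T r \<gamma> \<theta> t (\<lambda>y. max (y - D) 0) \<le> mv_cost P Q Y T r \<gamma> \<theta> t I"
proof -
  define c where "c = \<gamma> * exp (r * (T - t))"
  have "0 \<le> c" using \<open>0 \<le> \<gamma>\<close> by (simp add: c_def)
  have \<kappa>: "\<kappa> = 1 + c * D" "0 \<le> \<kappa>"
    using slope \<open>0 \<le> c\<close> \<open>0 \<le> D\<close> by (simp_all add: c_def)
  define ceded where "ceded = (\<lambda>y. I (min y D))"
  define retained where "retained = (\<lambda>y. (max y D - I (max y D)) - (D - I D))"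
  have posQ: "\<And>\<omega>. \<omega> \<in> space Q \<Longrightarrow> 0 \<le> Y \<omega>" using pos space by simp
  note I_simps = indemnity_zero[OF I] indemnity_nonneg[OF I] indemnity_mono[OF I]
    indemnity_growth[OF I] indemnity_le[OF I]
  have cont: "continuous_on {0..} I" by (rule indemnity_continuous_on[OF I])

  have ceded: "continuous_on {0..} ceded" "mono_on {0..} ceded" "ceded 0 = 0"
    "\<And>y. 0 \<le> y \<Longrightarrow> \<bar>ceded y\<bar> \<le> y"
  proof -
    show "continuous_on {0..} ceded" unfolding ceded_def
      by (rule continuous_on_compose2[OF cont]) (use \<open>0 \<le> D\<close> in \<open>auto intro!: continuous_intros\<close>)
    show "mono_on {0..} ceded" unfolding ceded_def
      using \<open>0 \<le> D\<close> by (intro mono_onI I_simps) auto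
    show "ceded 0 = 0" using \<open>0 \<le> D\<close> I_simps(1) by (simp add: ceded_def)
    show "\<bar>ceded y\<bar> \<le> y" if "0 \<le> y" for y
      using I_simps(2,5)[of "min y D"] that \<open>0 \<le> D\<close> by (simp add: ceded_def)
  qed
  have retained: "continuous_on {0..} retained" "mono_on {0..} retained" "retained 0 = 0"
    "\<And>y. 0 \<le> y \<Longrightarrow> \<bar>retained y\<bar> \<le> y"
  proof -
    show "continuous_on {0..} retained" unfolding retained_def
      by (intro continuous_intros continuous_on_compose2[OF cont]) (use \<open>0 \<le> D\<close> in auto)
    show "mono_on {0..} retained"
    proof (rule mono_onI)
      fix x y :: real assume "x \<in> {0..}" "y \<in> {0..}" "x \<le> y"
      then show "retained x \<le> retained y"
        using I_simps(4)[of "max x D" "max y D"] \<open>0 \<le> D\<close> by (simp add: retained_def) linarith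
    qed
    show "retained 0 = 0" using \<open>0 \<le> D\<close> by (simp add: retained_def max_absorb2)
    show "\<bar>retained y\<bar> \<le> y" if "0 \<le> y" for y
      using I_simps(3,4)[of D "max y D"] that \<open>0 \<le> D\<close> by (auto simp: retained_def)
  qed
  have decomp: "(y - I y) - min y D = retained y - ceded y" for y
    by (cases "y \<le> D") (auto simp: retained_def ceded_def max_def min_def)

  note integrable_P = integrable_dominated_by_claim[OF YP(1) pos]
  note integrable_Q = integrable_dominated_by_claim(1)[OF YQ posQ]
  have intP: "integrable P (\<lambda>\<omega>. ceded (Y \<omega>))" "integrable P (\<lambda>\<omega>. retained (Y \<omega>))"
    using integrable_P(1) ceded(1,4) retained(1,4) by blast+
  have intQ: "integrable Q (\<lambda>\<omega>. ceded (Y \<omega>))" "integrable Q (\<lambda>\<omega>. retained (Y \<omega>))"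
    using integrable_Q ceded(1,4) retained(1,4) by blast+
  have cont_min: "continuous_on {0..} (\<lambda>y. min y D)" and cont_ret: "continuous_on {0..} (\<lambda>y. y - I y)"
    by (intro continuous_intros cont)+
  have min_bd: "\<And>y. 0 \<le> y \<Longrightarrow> \<bar>min y D\<bar> \<le> y" and ret_bd: "\<And>y. 0 \<le> y \<Longrightarrow> \<bar>y - I y\<bar> \<le> y"
    using \<open>0 \<le> D\<close> I_simps(2,5) by (auto simp: min_def)
  have intR: "integrable P (\<lambda>\<omega>. min (Y \<omega>) D)" "integrable P (\<lambda>\<omega>. (min (Y \<omega>) D)\<^sup>2)"
    "integrable P (\<lambda>\<omega>. Y \<omega> - I (Y \<omega>))" "integrable P (\<lambda>\<omega>. (Y \<omega> - I (Y \<omega>))\<^sup>2)"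
    using integrable_P(1)[OF _ cont_min min_bd] integrable_P(2)[OF _ cont_min min_bd YP(2)]
      integrable_P(1)[OF _ cont_ret ret_bd] integrable_P(2)[OF _ cont_ret ret_bd YP(2)] by auto
  have intI: "integrable Q (\<lambda>\<omega>. I (Y \<omega>))" "integrable Q (\<lambda>\<omega>. max (Y \<omega> - D) 0)"
  proof -
    show "integrable Q (\<lambda>\<omega>. I (Y \<omega>))"
      using I_simps(2,5) by (intro integrable_Q[of I] cont) auto
    show "integrable Q (\<lambda>\<omega>. max (Y \<omega> - D) 0)"
      using \<open>0 \<le> D\<close> by (intro integrable_Q[of "\<lambda>y. max (y - D) 0"] continuous_intros) auto
  qed

  \<comment> \<open>The retained excess grows only above \<open>D\<close>, so only tails beyond \<open>D\<close> enter; ceding them costs no more than retaining them.\<close>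
  have exp_retained: "(1 + \<theta>) * (LINT \<omega>|Q. retained (Y \<omega>)) \<le> \<kappa> * (LINT \<omega>|P. retained (Y \<omega>))"
  proof (rule expectation_le_if_tails_le[OF assms(2,1) intQ(2) intP(2) posQ pos retained(1-3)])
    fix z :: real assume "0 \<le> z" "0 < retained z"
    then have "D < z" by (intro not_le_imp_less notI) (simp add: retained_def max_absorb2)
    then show "(1 + \<theta>) * measure Q {\<omega> \<in> space Q. z < Y \<omega>} \<le> \<kappa> * measure P {\<omega> \<in> space P. z < Y \<omega>}"
      by (rule above)
  qed (use \<open>0 \<le> \<theta>\<close> \<kappa> in auto)
  \<comment> \<open>The ceded part is constant from \<open>D\<close> on, so only tails before \<open>D\<close> enter; retaining them costs no more than ceding them.\<close>
  have exp_ceded: "\<kappa> * (LINT \<omega>|P. ceded (Y \<omega>)) \<le> (1 + \<theta>) * (LINT \<omega>|Q. ceded (Y \<omega>))"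
  proof (rule expectation_le_if_tails_le[OF assms(1,2) intP(1) intQ(1) pos posQ ceded(1-3)])
    fix z y :: real assume "0 \<le> z" "ceded z < ceded y" "0 \<le> y"
    moreover have "ceded y \<le> ceded D"
      using I_simps(3)[of "min y D" D] \<open>0 \<le> y\<close> \<open>0 \<le> D\<close> by (simp add: ceded_def)
    ultimately have "z < D" by (intro not_le_imp_less notI) (simp add: ceded_def min_absorb2)
    then show "\<kappa> * measure P {\<omega> \<in> space P. z < Y \<omega>} \<le> (1 + \<theta>) * measure Q {\<omega> \<in> space Q. z < Y \<omega>}"
      using \<open>0 \<le> z\<close> below by simp
  qed (use \<open>0 \<le> \<theta>\<close> \<kappa> in auto)

  have stop_loss_retention: "y - max (y - D) 0 = min y D" for y :: real by auto
  have Q_diff: "(LINT \<omega>|Q. max (Y \<omega> - D) 0) - (LINT \<omega>|Q. I (Y \<omega>)) =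
      (LINT \<omega>|Q. retained (Y \<omega>)) - (LINT \<omega>|Q. ceded (Y \<omega>))"
  proof -
    have "max (y - D) 0 - I y = retained y - ceded y" for y
      using decomp[of y] stop_loss_retention[of y] by linarith
    then show ?thesis using intI intQ by (simp flip: Bochner_Integration.integral_diff)
  qed
  have P_diff: "(LINT \<omega>|P. Y \<omega> - I (Y \<omega>)) - (LINT \<omega>|P. min (Y \<omega>) D) =
      (LINT \<omega>|P. retained (Y \<omega>)) - (LINT \<omega>|P. ceded (Y \<omega>))"
    using intR intP by (simp add: decomp flip: Bochner_Integration.integral_diff)
  have "2 * D * ((LINT \<omega>|P. Y \<omega> - I (Y \<omega>)) - (LINT \<omega>|P. min (Y \<omega>) D)) =
      (LINT \<omega>|P. 2 * D * ((Y \<omega> - I (Y \<omega>)) - min (Y \<omega>) D))"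
    using intR by simp
  also have "\<dots> \<le> (LINT \<omega>|P. (Y \<omega> - I (Y \<omega>))\<^sup>2 - (min (Y \<omega>) D)\<^sup>2)"
    using intR pos I_simps(2)
    by (intro integral_mono quadratic_tangent_at_deductible) auto
  also have "\<dots> = (LINT \<omega>|P. (Y \<omega> - I (Y \<omega>))\<^sup>2) - (LINT \<omega>|P. (min (Y \<omega>) D)\<^sup>2)"
    using intR by simp
  finally have square_diff: "2 * D * ((LINT \<omega>|P. retained (Y \<omega>)) - (LINT \<omega>|P. ceded (Y \<omega>))) \<le>
      (LINT \<omega>|P. (Y \<omega> - I (Y \<omega>))\<^sup>2) - (LINT \<omega>|P. (min (Y \<omega>) D)\<^sup>2)"
    unfolding P_diff .
  have "0 \<le> \<kappa> * ((LINT \<omega>|P. retained (Y \<omega>)) - (LINT \<omega>|P. ceded (Y \<omega>)))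
        - (1 + \<theta>) * ((LINT \<omega>|Q. retained (Y \<omega>)) - (LINT \<omega>|Q. ceded (Y \<omega>)))"
    using exp_retained exp_ceded by (simp add: right_diff_distrib)
  also have "\<dots> \<le> ((LINT \<omega>|P. retained (Y \<omega>)) - (LINT \<omega>|P. ceded (Y \<omega>)))
        + c / 2 * ((LINT \<omega>|P. (Y \<omega> - I (Y \<omega>))\<^sup>2) - (LINT \<omega>|P. (min (Y \<omega>) D)\<^sup>2))
        - (1 + \<theta>) * ((LINT \<omega>|Q. retained (Y \<omega>)) - (LINT \<omega>|Q. ceded (Y \<omega>)))"
    using mult_left_mono[OF square_diff, of "c / 2"] \<open>0 \<le> c\<close> by (simp add: \<kappa>(1) algebra_simps)
  also have "\<dots> = mv_cost P Q Y T r \<gamma> \<theta> t I - mv_cost P Q Y T r \<gamma> \<theta> t (\<lambda>y. max (y - D) 0)"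
    unfolding P_diff[symmetric] Q_diff[symmetric] mv_cost_def stop_loss_retention c_def
    by (simp add: algebra_simps)
  finally show ?thesis by simp
qed

section \<open>The deductible separates the tails\<close>

lemma distortion_quotient_zero:
  assumes "g differentiable_on {0..1}" "g 0 = 0"
  shows "((\<lambda>u. g u / u) \<longlongrightarrow> distortion_quotient g 0) (at_right 0)"
proof -
  obtain g' where "(g has_field_derivative g') (at 0 within {0..1})"
    using assms(1) by (force simp: differentiable_on_def real_differentiable_def)
  then have "((\<lambda>u. g u / u) \<longlongrightarrow> g') (at_right 0)"
    using assms(2) by (simp add: has_field_derivative_iff at_within_Icc_at_right)
  moreover from this have "distortion_quotient g 0 = g'"
    by (simp add: distortion_quotient_def tendsto_Lim)
  ultimately show ?thesis by simp
qed

text \<open>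
  The quotient is the slope of the chord of \<open>g\<close> from the origin, which convexity makes
  non-decreasing; the slope at the origin follows in the limit.
\<close>

lemma distortion_quotient_mono:
  assumes conv: "convex_on {0..1} g" and diff: "g differentiable_on {0..1}" and g0: "g 0 = 0"
    and s: "0 \<le> s" "s \<le> s'" "s' \<le> 1"
  shows "distortion_quotient g s \<le> distortion_quotient g s'"
proof -
  have chord: "g u / u \<le> g v / v" if "0 < u" "u \<le> v" "v \<le> 1" for u v
  proof -
    have "g u \<le> u / v * g v"
      using convex_onD[OF conv, of "u / v" 0 v] that g0 by simp
    then show ?thesis using that by (simp add: field_simps)
  qed
  show ?thesis
  proof (cases "s = 0 \<and> 0 < s'")
    case True
    have "eventually (\<lambda>u. u \<in> {0<..<s'}) (at_right 0)"
      using True by (auto simp: eventually_at_right)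
    then have "eventually (\<lambda>u. g u / u \<le> g s' / s') (at_right 0)"
      by eventually_elim (use chord s in auto)
    then have "distortion_quotient g 0 \<le> g s' / s'"
      by (intro tendsto_upperbound[OF distortion_quotient_zero[OF diff g0]]) auto
    then show ?thesis using True by (simp add: distortion_quotient_def)
  next
    case False
    then show ?thesis using chord[of s s'] s by (auto simp: distortion_quotient_def)
  qed
qed

text \<open>
  Only points strictly on either side of the deductible are compared, so that it does not matter
  whether the infimum is attained.
\<close>

lemma deductible_separates_tails:
  fixes S g :: "real \<Rightarrow> real" and T r t :: real
  assumes "0 < \<gamma>" "0 \<le> \<theta>"
    and S: "antimono S" "\<And>z. 0 \<le> S z" "\<And>z. S z \<le> 1"
    and dist: "distortion g" and conv: "convex_on {0..1} g" and diff: "g differentiable_on {0..1}"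
  defines "D \<equiv> deductible T r \<gamma> \<theta> g S t"
  defines "\<kappa> \<equiv> 1 + \<gamma> * exp (r * (T - t)) * D"
  shows "0 \<le> D"
    and "\<And>z. 0 \<le> z \<Longrightarrow> z < D \<Longrightarrow> \<kappa> * S z \<le> (1 + \<theta>) * g (S z)"
    and "\<And>z. D < z \<Longrightarrow> (1 + \<theta>) * g (S z) \<le> \<kappa> * S z"
proof -
  define c where "c = \<gamma> * exp (r * (T - t))"
  have "0 < c" using \<open>0 < \<gamma>\<close> by (simp add: c_def)
  define q where "q = (\<lambda>z. (1 + \<theta>) * distortion_quotient g (S z))"
  define A where "A = {d. 0 \<le> d \<and> q d \<le> 1 + c * d}"
  have D: "D = Inf A" by (simp add: D_def deductible_def A_def q_def c_def)
  have g: "g 0 = 0" "g 1 = 1" using dist by (auto simp: distortion_def)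
  note dq_mono = distortion_quotient_mono[OF conv diff g(1)]
  have q_antimono: "q w \<le> q z" if "z \<le> w" for z w
    unfolding q_def using S antimonoD[OF S(1) that] \<open>0 \<le> \<theta>\<close>
    by (intro mult_left_mono dq_mono) auto
  have q_eq: "q z * S z = (1 + \<theta>) * g (S z)" for z
    using g(1) by (simp add: q_def distortion_quotient_def)
  have "distortion_quotient g (S z) \<le> 1" for z
    using dq_mono[of "S z" 1] S g(2) by (simp add: distortion_quotient_def)
  then have q_le: "q z \<le> 1 + \<theta>" for z
    using \<open>0 \<le> \<theta>\<close> by (simp add: q_def mult_left_le)
  \<comment> \<open>At \<open>d = \<theta> / c\<close> the marginal cost \<open>1 + c d\<close> equals \<open>1 + \<theta>\<close>, and the quotient is at most \<open>g(1) = 1\<close>.\<close>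
  have ne: "A \<noteq> {}"
  proof -
    have "\<theta> / c \<in> A"
      using q_le[of "\<theta> / c"] \<open>0 < c\<close> \<open>0 \<le> \<theta>\<close> by (simp add: A_def)
    then show ?thesis by blast
  qed
  have bdd: "bdd_below A" by (auto simp: A_def intro!: bdd_belowI[of _ 0])
  show "0 \<le> D" unfolding D by (rule cInf_greatest[OF ne]) (simp add: A_def)
  have \<kappa>: "\<kappa> = 1 + c * D" by (simp add: \<kappa>_def c_def)
  have lim: "x * c + 1 \<le> b \<Longrightarrow> x \<le> (b - 1) / c" "b \<le> x * c + 1 \<Longrightarrow> (b - 1) / c \<le> x" for x b
    using \<open>0 < c\<close> by (simp_all add: field_simps)

  show "\<kappa> * S z \<le> (1 + \<theta>) * g (S z)" if "0 \<le> z" "z < D" for z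
  proof -
    have "w \<le> (q z - 1) / c" if "z < w" "w < D" for w
    proof -
      have "w \<notin> A" using \<open>w < D\<close> cInf_lower[OF _ bdd] unfolding D by fastforce
      then have "1 + c * w < q w" using \<open>0 \<le> z\<close> \<open>z < w\<close> by (simp add: A_def)
      also have "q w \<le> q z" using \<open>z < w\<close> by (intro q_antimono) simp
      finally show ?thesis by (intro lim) (simp add: mult.commute)
    qed
    then have "D \<le> (q z - 1) / c" using \<open>z < D\<close> by (rule dense_le_bounded[rotated])
    then have "\<kappa> \<le> q z" using \<open>0 < c\<close> by (simp add: \<kappa> field_simps)
    from mult_right_mono[OF this S(2)[of z]] show ?thesis by (simp add: q_eq)
  qed
  show "(1 + \<theta>) * g (S z) \<le> \<kappa> * S z" if "D < z" for z
  proof -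
    have "(q z - 1) / c \<le> w" if "D < w" "w < z" for w
    proof -
      obtain d where "d \<in> A" "d < w"
        using \<open>D < w\<close> cInf_lessD[OF ne] unfolding D by blast
      have "q z \<le> q d" using \<open>d < w\<close> \<open>w < z\<close> by (intro q_antimono) simp
      also have "q d \<le> 1 + c * d" using \<open>d \<in> A\<close> by (simp add: A_def)
      also have "\<dots> \<le> 1 + c * w" using \<open>d < w\<close> \<open>0 < c\<close> by simp
      finally show ?thesis by (intro lim) (simp add: mult.commute)
    qed
    then have "(q z - 1) / c \<le> D" using \<open>D < z\<close> by (rule dense_ge_bounded[rotated])
    then have "q z \<le> \<kappa>" using \<open>0 < c\<close> by (simp add: \<kappa> field_simps)
    from mult_right_mono[OF this S(2)[of z]] show ?thesis by (simp add: q_eq)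
  qed
qed

section \<open>The optimal indemnity\<close>

lemma tail_probability_eq:
  assumes "prob_space M" and [measurable]: "Y \<in> borel_measurable M"
  shows "measure M {\<omega> \<in> space M. z < Y \<omega>} = 1 - cdf (distr M borel Y) z"
proof -
  interpret prob_space M by fact
  have "cdf (distr M borel Y) z = measure M {\<omega> \<in> space M. Y \<omega> \<le> z}"
    by (auto simp: cdf_def2 measure_distr intro!: arg_cong[where f = "measure M"])
  also have "\<dots> = 1 - measure M {\<omega> \<in> space M. z < Y \<omega>}"
    using prob_neg[of "\<lambda>\<omega>. z < Y \<omega>"] by (simp add: not_less)
  finally show ?thesis by simp
qed

theorem proposition3:
  fixes P Q :: "'a measure"
    and Y :: "'a \<Rightarrow> real"
    and T r \<gamma> \<theta> :: real
    and F FQ S g :: "real \<Rightarrow> real"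
    and LR :: "real \<Rightarrow> ennreal"
  assumes "T > 0" and "r > 0" and "\<gamma> > 0" and "\<theta> \<ge> 0"
    and "prob_space P" and "prob_space Q" and "sets Q = sets P"
    and "Y \<in> borel_measurable P" and "\<And>\<omega>. \<omega> \<in> space P \<Longrightarrow> Y \<omega> > 0"
    and "integrable P Y" and "integrable P (\<lambda>\<omega>. (Y \<omega>)\<^sup>2)"
    and "integrable Q Y" and "integrable Q (\<lambda>\<omega>. (Y \<omega>)\<^sup>2)"
    and "F = cdf (distr P borel Y)" and "FQ = cdf (distr Q borel Y)"
    and "S = (\<lambda>y. 1 - F y)"
    and "\<exists>f. distributed P lborel Y f"
    and "likelihood_ratio P Q Y LR"
    and "\<And>a. finite_variation_on {0..a} (\<lambda>y. enn2real (LR y))"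
    and "finite (break_points (\<lambda>y. enn2real (LR y)) F)"
    and "\<And>t. t \<in> {0..T} \<Longrightarrow>
           piecewise_slope_regimes (marginal_slope T r \<gamma> \<theta> (\<lambda>y. enn2real (LR y)) t)
             (break_points (\<lambda>y. enn2real (LR y)) F)"
    and "distortion g" and "convex_on {0..1} g" and "g differentiable_on {0..1}"
    and "\<And>y. y \<ge> 0 \<Longrightarrow> FQ y = 1 - g (S y)"
  shows "optimal_indemnity P Q Y T r \<gamma> \<theta>
           (\<lambda>t y. max (y - deductible T r \<gamma> \<theta> g S t) 0)"
proof -
  interpret P: prob_space P by fact
  interpret Q: prob_space Q by fact
  have [measurable]: "Y \<in> borel_measurable P" "Y \<in> borel_measurable Q"
    using \<open>integrable P Y\<close> \<open>integrable Q Y\<close> by auto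
  have space: "space Q = space P"
    using \<open>sets Q = sets P\<close> by (rule sets_eq_imp_space_eq)
  have pos: "\<And>\<omega>. \<omega> \<in> space P \<Longrightarrow> 0 \<le> Y \<omega>"
    using assms(9) by (simp add: less_imp_le)
  have tailP: "measure P {\<omega> \<in> space P. z < Y \<omega>} = S z" for z
    using tail_probability_eq[OF P.prob_space_axioms, of Y z] assms(14,16) by simp
  have tailQ: "measure Q {\<omega> \<in> space Q. z < Y \<omega>} = g (S z)" if "0 \<le> z" for z
    using tail_probability_eq[OF Q.prob_space_axioms, of Y z] assms(15) assms(25)[OF that] by simp
  have S: "antimono S" "0 \<le> S z" "S z \<le> 1" for z
  proof -
    show "antimono S"
      by (auto simp flip: tailP intro!: antimonoI P.finite_measure_mono)
    show "0 \<le> S z" "S z \<le> 1" by (simp_all flip: tailP)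
  qed
  show ?thesis
    unfolding optimal_indemnity_def
  proof
    fix t assume "t \<in> {0..T}"
    define D where "D = deductible T r \<gamma> \<theta> g S t"
    note separation = deductible_separates_tails[OF \<open>\<gamma> > 0\<close> \<open>\<theta> \<ge> 0\<close> S assms(22-24),
        where T = T and r = r and t = t, folded D_def]
    have "mv_cost P Q Y T r \<gamma> \<theta> t (\<lambda>y. max (y - D) 0) \<le> mv_cost P Q Y T r \<gamma> \<theta> t I"
      if "I \<in> indemnities" for I
    proof (rule stop_loss_cost_le[OF P.finite_measure_axioms Q.finite_measure_axioms space pos
            assms(10-12) _ _ separation(1) refl _ _ that])
      fix z
      show "(1 + \<gamma> * exp (r * (T - t)) * D) * measure P {\<omega> \<in> space P. z < Y \<omega>} \<le>
          (1 + \<theta>) * measure Q {\<omega> \<in> space Q. z < Y \<omega>}" if "0 \<le> z" "z < D"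
        using separation(2)[OF that] that by (simp add: tailP tailQ)
      show "(1 + \<theta>) * measure Q {\<omega> \<in> space Q. z < Y \<omega>} \<le>
          (1 + \<gamma> * exp (r * (T - t)) * D) * measure P {\<omega> \<in> space P. z < Y \<omega>}" if "D < z"
        using separation(3)[OF that] separation(1) that by (simp add: tailP tailQ)
    qed (use \<open>\<gamma> > 0\<close> \<open>\<theta> \<ge> 0\<close> in auto)
    then show "is_arg_min (mv_cost P Q Y T r \<gamma> \<theta> t) (\<lambda>J. J \<in> indemnities)
        (\<lambda>y. max (y - deductible T r \<gamma> \<theta> g S t) 0)"
      using stop_loss_in_indemnities[OF separation(1)]
      by (auto simp: is_arg_min_def D_def not_less)
  qed
qed

end
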